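(* Let $E$ be a Banach space, let $C\subseteq E$ be a cone which is normal with normal constant $K$, and let $(V,\|\cdot\|_c)$ be a finite dimensional cone normed linear space over $\mathbf{R}$ with cone norm $\|\cdot\|_c:V\to E$. Then $(V,\|\cdot\|_c)$ is cone complete.
   Context: $E$ is a Banach space (regarded as a real vector space) with norm $\|\cdot\|$ and null element $\theta$. A non-empty subset $C\subseteq E$ is a cone if: (i) $C$ is closed; (ii) $a,b\in\mathbf{R}$, $a,b\ge 0$, $x,y\in C$ imply $ax+by\in C$; (iii) for every $x\in E$, $x\in C$ or $-x\in C$. For $x,y\in E$: $x\le y$ (also written $y\ge x$) means $y-x\in C$; $x\ll y$ (also written $y\gg x$) means $y-x\in \operatorname{int} C$, the interior of $C$. The cone $C$ is normal if there is a number $K>0$ such that for all $x,y\in E$, $\theta\le x\le y$ implies $\|x\|\le K\|y\|$; the least such positive number is the normal constant of $C$. A cone norm on a real vector space $V$ is a map $\|\cdot\|_c:V\to E$ such that (i) $\|x\|_c\ge\theta$ for all $x\in V$; (ii) $\|x\|_c=\theta$ if and only if $x=\theta_V$ (the zero of $V$); (iii) $\|\alpha x\|_c=|\alpha|\,\|x\|_c$ for all $x\in V$, $\alpha\in\mathbf{R}$; (iv) $\|x+y\|_c\le\|x\|_c+\|y\|_c$ for all $x,y\in V$. Then $(V,\|\cdot\|_c)$ is called a cone normed linear space. A sequence $\{x_n\}$ in $V$ converges to $x\in V$ if for every $\epsilon\in E$ with $\epsilon\gg\theta$ there is a positive integer $n_0$ such that $\|x_n-x\|_c\ll\epsilon$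 for all $n\ge n_0$. It is a Cauchy sequence if for every $\epsilon\in E$ with $\epsilon\gg\theta$ there is a positive integer $n_0$ such that $\|x_n-x_m\|_c\ll\epsilon$ for all $m,n\ge n_0$. $(V,\|\cdot\|_c)$ is cone complete if every Cauchy sequence in $V$ converges to a point of $V$. *)

theory Defs
  imports "HOL-Analysis.Analysis"
begin

text \<open>
  The third cone axiom is totality (\<open>x \<in> C\<close> or \<open>- x \<in> C\<close>), not the more common
  pointedness axiom (\<open>x \<in> C\<close> and \<open>- x \<in> C\<close> imply \<open>x = 0\<close>).
\<close>

definition is_cone :: "'e::banach set \<Rightarrow> bool" where
  "is_cone C \<longleftrightarrow>
     C \<noteq> {} \<and>
     closed C \<and>
     (\<forall>a b x y. a \<ge> 0 \<longrightarrow> b \<ge> 0 \<longrightarrow> x \<in> C \<longrightarrow> y \<in> C \<longrightarrow> a *\<^sub>R x + b *\<^sub>R y \<in> C) \<and>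
     (\<forall>x. x \<in> C \<or> - x \<in> C)"

definition cone_le :: "'e::banach set \<Rightarrow> 'e \<Rightarrow> 'e \<Rightarrow> bool" where
  "cone_le C x y \<longleftrightarrow> y - x \<in> C"

definition cone_ll :: "'e::banach set \<Rightarrow> 'e \<Rightarrow> 'e \<Rightarrow> bool" where
  "cone_ll C x y \<longleftrightarrow> y - x \<in> interior C"

definition normality_bound :: "'e::banach set \<Rightarrow> real \<Rightarrow> bool" where
  "normality_bound C K \<longleftrightarrow>
     K > 0 \<and> (\<forall>x y. cone_le C 0 x \<longrightarrow> cone_le C x y \<longrightarrow> norm x \<le> K * norm y)"

definition normal_cone :: "'e::banach set \<Rightarrow> bool" where
  "normal_cone C \<longleftrightarrow> (\<exists>K. normality_bound C K)"

text \<open>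
  For a normal cone the least bound exists unless \<open>C = {0}\<close>. In that degenerate case every
  positive number is a bound, and the value below is unspecified.
\<close>

definition normal_constant :: "'e::banach set \<Rightarrow> real" where
  "normal_constant C = (LEAST K. normality_bound C K)"

definition cone_norm :: "'e::banach set \<Rightarrow> ('v::real_vector \<Rightarrow> 'e) \<Rightarrow> bool" where
  "cone_norm C N \<longleftrightarrow>
     (\<forall>x. cone_le C 0 (N x)) \<and>
     (\<forall>x. N x = 0 \<longleftrightarrow> x = 0) \<and>
     (\<forall>\<alpha> x. N (\<alpha> *\<^sub>R x) = \<bar>\<alpha>\<bar> *\<^sub>R N x) \<and>
     (\<forall>x y. cone_le C (N (x + y)) (N x + N y))"

definition cone_converges_to ::
    "'e::banach set \<Rightarrow> ('v::real_vector \<Rightarrow> 'e) \<Rightarrow> (nat \<Rightarrow> 'v) \<Rightarrow> 'v \<Rightarrow> bool" where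
  "cone_converges_to C N X x \<longleftrightarrow>
     (\<forall>\<epsilon>. cone_ll C 0 \<epsilon> \<longrightarrow> (\<exists>n0>0. \<forall>n\<ge>n0. cone_ll C (N (X n - x)) \<epsilon>))"

definition cone_Cauchy ::
    "'e::banach set \<Rightarrow> ('v::real_vector \<Rightarrow> 'e) \<Rightarrow> (nat \<Rightarrow> 'v) \<Rightarrow> bool" where
  "cone_Cauchy C N X \<longleftrightarrow>
     (\<forall>\<epsilon>. cone_ll C 0 \<epsilon> \<longrightarrow> (\<exists>n0>0. \<forall>m\<ge>n0. \<forall>n\<ge>n0. cone_ll C (N (X n - X m)) \<epsilon>))"

definition cone_complete :: "'e::banach set \<Rightarrow> ('v::real_vector \<Rightarrow> 'e) \<Rightarrow> bool" where
  "cone_complete C N \<longleftrightarrow> (\<forall>X. cone_Cauchy C N X \<longrightarrow> (\<exists>x. cone_converges_to C N X x))"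

end

theory Submission
  imports Defs
begin

text \<open>
  Normality turns \<open>p x = \<parallel>N x\<parallel>\<close> into a real-valued quasi-norm: \<open>p (x + y) \<le> K (p x + p y)\<close>.
  If \<open>C\<close> has an interior point, cone Cauchy sequences are \<open>p\<close>-Cauchy and \<open>p\<close>-convergent
  sequences cone converge; otherwise every sequence cone converges to every point.
  The classical argument that linear coordinates on a finite-dimensional normed space are bounded
  by the norm survives for quasi-norms, and gives \<open>p\<close>-completeness.
\<close>

section \<open>Real-valued quasi-norms and completeness of finite-dimensional spans\<close>

locale quasi_norm =
  fixes p :: "'v::real_vector \<Rightarrow> real" and K :: real
  assumes K_pos: "K > 0"
    and eq_0_iff: "p x = 0 \<longleftrightarrow> x = 0"
    and scale: "p (a *\<^sub>R x) = \<bar>a\<bar> * p x"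
    and quasi_triangle: "p (x + y) \<le> K * (p x + p y)"
begin

lemma zero [simp]: "p 0 = 0"
  by (simp add: eq_0_iff)

lemma minus [simp]: "p (- x) = p x"
  using scale[of "-1" x] by simp

text \<open>The vectors \<open>x\<close> and \<open>- x\<close> sum to zero, so the quasi-triangle
  inequality reads \<open>0 \<le> 2 * K * p x\<close>.\<close>

lemma nonneg [simp]: "p x \<ge> 0"
  using quasi_triangle[of x "- x"] K_pos by (simp add: zero_le_mult_iff)

lemma minus_commute: "p (x - y) = p (y - x)"
  using minus[of "x - y"] by simp

lemma quasi_triangle_diff: "p (x - z) \<le> K * (p (x - y) + p (y - z))"
  using quasi_triangle[of "x - y" "y - z"] by simp

text \<open>Each vector added costs one more factor \<open>K\<close>, so \<open>M\<close> depends on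
  \<open>B\<close> but not on \<open>f\<close>. This turns convergence of coordinates into
  convergence in \<open>p\<close>.\<close>

lemma sum_bounded:
  assumes "finite B"
  shows "\<exists>M. \<forall>f. p (\<Sum>b\<in>B. f b *\<^sub>R b) \<le> M * (\<Sum>b\<in>B. \<bar>f b\<bar>)"
  using assms
proof (induction B rule: finite_induct)
  case empty
  then show ?case by simp
next
  case (insert b B)
  then obtain M where M: "\<And>f. p (\<Sum>b\<in>B. f b *\<^sub>R b) \<le> M * (\<Sum>b\<in>B. \<bar>f b\<bar>)"
    by blast
  have "p (\<Sum>b\<in>insert b B. f b *\<^sub>R b) \<le> (K * (p b + \<bar>M\<bar>)) * (\<Sum>b\<in>insert b B. \<bar>f b\<bar>)" for f
  proof -
    define s where "s = (\<Sum>b\<in>B. \<bar>f b\<bar>)"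
    have s: "s \<ge> 0"
      by (simp add: s_def sum_nonneg)
    have "p (\<Sum>b\<in>insert b B. f b *\<^sub>R b) \<le> K * (\<bar>f b\<bar> * p b + p (\<Sum>b\<in>B. f b *\<^sub>R b))"
      using insert.hyps quasi_triangle[of "f b *\<^sub>R b"] by (simp add: scale)
    also have "\<dots> \<le> K * (\<bar>f b\<bar> * p b + M * s)"
      using M[of f] K_pos by (simp add: s_def)
    \<comment> \<open>The induction hypothesis leaves the sign of \<open>M\<close> open, hence
      \<open>\<bar>M\<bar>\<close>; the cross terms \<open>p b * s\<close> and
      \<open>\<bar>M\<bar> * \<bar>f b\<bar>\<close> are nonnegative.\<close>
    also have "\<dots> \<le> K * ((p b + \<bar>M\<bar>) * (\<bar>f b\<bar> + s))"
    proof -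
      have "M * s \<le> \<bar>M\<bar> * s"
        using s by (intro mult_right_mono) auto
      moreover have "0 \<le> p b * s" "0 \<le> \<bar>M\<bar> * \<bar>f b\<bar>"
        using s by simp_all
      ultimately have "\<bar>f b\<bar> * p b + M * s \<le> (p b + \<bar>M\<bar>) * (\<bar>f b\<bar> + s)"
        unfolding distrib_left distrib_right mult.commute[of "p b" "\<bar>f b\<bar>"] by linarith
      then show ?thesis
        using K_pos by simp
    qed
    finally show ?thesis
      using insert.hyps by (simp add: s_def mult.assoc)
  qed
  then show ?case by blast
qed

definition Cauchy_seq :: "(nat \<Rightarrow> 'v) \<Rightarrow> bool" where
  "Cauchy_seq X \<longleftrightarrow> (\<forall>e>0. \<exists>n0. \<forall>m\<ge>n0. \<forall>n\<ge>n0. p (X n - X m) < e)"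

lemma Cauchy_seq_if_tendsto:
  assumes "(\<lambda>n. p (X n - x)) \<longlonglongrightarrow> 0"
  shows "Cauchy_seq X"
  unfolding Cauchy_seq_def
proof (intro allI impI)
  fix e :: real assume "e > 0"
  then have "e / (2 * K) > 0"
    using K_pos by simp
  from order_tendstoD(2)[OF assms this] obtain n0 where n0: "\<And>n. n \<ge> n0 \<Longrightarrow> p (X n - x) < e / (2 * K)"
    by (auto simp: eventually_sequentially)
  have "p (X n - X m) < e" if "m \<ge> n0" "n \<ge> n0" for m n
  proof -
    have "p (X n - X m) \<le> K * (p (X n - x) + p (X m - x))"
      using quasi_triangle_diff[of "X n" "X m" x] by (simp add: minus_commute[of x])
    also have "\<dots> < K * (e / (2 * K) + e / (2 * K))"
      using n0[OF that(1)] n0[OF that(2)] K_pos by (intro mult_strict_left_mono) auto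
    also have "\<dots> = e"
      using K_pos by simp
    finally show ?thesis .
  qed
  then show "\<exists>n0. \<forall>m\<ge>n0. \<forall>n\<ge>n0. p (X n - X m) < e" by blast
qed

text \<open>The bound \<open>c\<close> makes each coordinate sequence Cauchy in the reals, and the
  limits of the coordinates define \<open>x\<close>. The bound is a hypothesis so that the lemma can
  serve inside the induction that proves it, for the smaller set.\<close>

lemma span_complete_if_coordinates_bounded:
  assumes "finite B"
    and c: "\<And>f. (\<Sum>b\<in>B. \<bar>f b\<bar>) \<le> c * p (\<Sum>b\<in>B. f b *\<^sub>R b)"
    and "Cauchy_seq X" and "range X \<subseteq> span B"
  shows "\<exists>x\<in>span B. (\<lambda>n. p (X n - x)) \<longlonglongrightarrow> 0"
proof -
  have "\<forall>n. \<exists>f. X n = (\<Sum>b\<in>B. f b *\<^sub>R b)"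
    using assms(4) unfolding span_finite[OF assms(1)] by blast
  then obtain f where f: "\<And>n. X n = (\<Sum>b\<in>B. f n b *\<^sub>R b)"
    by metis
  have diff: "(\<Sum>b\<in>B. \<bar>f n b - f m b\<bar>) \<le> c * p (X n - X m)" for m n
    using c[of "\<lambda>b. f n b - f m b"] by (simp add: f scaleR_diff_left sum_subtractf)
  have "convergent (\<lambda>n. f n b)" if "b \<in> B" for b
    unfolding Cauchy_convergent_iff[symmetric]
  proof (rule CauchyI)
    fix e :: real assume "e > 0"
    \<comment> \<open>\<open>\<bar>c\<bar> + 1\<close> is a positive upper bound for
      \<open>c\<close>, whatever its sign.\<close>
    then have "e / (\<bar>c\<bar> + 1) > 0" by simp
    then obtain n0 where n0: "\<And>m n. m \<ge> n0 \<Longrightarrow> n \<ge> n0 \<Longrightarrow> p (X n - X m) < e / (\<bar>c\<bar> + 1)"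
      using assms(3) unfolding Cauchy_seq_def by blast
    have "norm (f m b - f n b) < e" if "m \<ge> n0" "n \<ge> n0" for m n
    proof -
      have "\<bar>f m b - f n b\<bar> \<le> (\<Sum>b\<in>B. \<bar>f m b - f n b\<bar>)"
        using \<open>b \<in> B\<close> assms(1) by (intro member_le_sum) auto
      also have "\<dots> \<le> c * p (X m - X n)" by (rule diff)
      also have "\<dots> \<le> (\<bar>c\<bar> + 1) * p (X m - X n)"
        by (intro mult_right_mono) auto
      also have "\<dots> < (\<bar>c\<bar> + 1) * (e / (\<bar>c\<bar> + 1))"
        using n0[OF that(2,1)] by (intro mult_strict_left_mono) auto
      also have "\<dots> = e" by (simp add: field_simps)
      finally show ?thesis by simp
    qed
    then show "\<exists>M. \<forall>m\<ge>M. \<forall>n\<ge>M. norm (f m b - f n b) < e" by blast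
  qed
  then obtain g where g: "\<And>b. b \<in> B \<Longrightarrow> (\<lambda>n. f n b) \<longlonglongrightarrow> g b"
    unfolding convergent_def by metis
  define x where "x = (\<Sum>b\<in>B. g b *\<^sub>R b)"
  obtain M where M: "\<And>f. p (\<Sum>b\<in>B. f b *\<^sub>R b) \<le> M * (\<Sum>b\<in>B. \<bar>f b\<bar>)"
    using sum_bounded[OF assms(1)] by blast
  have "p (X n - x) \<le> M * (\<Sum>b\<in>B. \<bar>f n b - g b\<bar>)" for n
    using M[of "\<lambda>b. f n b - g b"] by (simp add: f x_def scaleR_diff_left sum_subtractf)
  moreover have "(\<lambda>n. M * (\<Sum>b\<in>B. \<bar>f n b - g b\<bar>)) \<longlonglongrightarrow> M * (\<Sum>b\<in>B. \<bar>g b - g b\<bar>)"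
    by (intro tendsto_intros g)
  then have "(\<lambda>n. M * (\<Sum>b\<in>B. \<bar>f n b - g b\<bar>)) \<longlonglongrightarrow> 0"
    by simp
  ultimately have "(\<lambda>n. p (X n - x)) \<longlonglongrightarrow> 0"
    by (intro Lim_null_comparison[where f = "\<lambda>n. p (X n - x)"]) auto
  moreover have "x \<in> span B"
    unfolding x_def by (intro span_sum span_scale span_base)
  ultimately show ?thesis by blast
qed

text \<open>By induction, \<open>span B\<close> is complete for \<open>p\<close>, so a new vector
  \<open>b\<close> outside it stays at a positive distance \<open>d\<close> from it. This bounds the
  coefficient of \<open>b\<close>; subtracting its term leaves a vector of \<open>span B\<close>,
  where the induction hypothesis applies.\<close>

lemma coordinates_bounded:
  assumes "finite B" and "independent B"
  shows "\<exists>c. \<forall>f. (\<Sum>b\<in>B. \<bar>f b\<bar>) \<le> c * p (\<Sum>b\<in>B. f b *\<^sub>R b)"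
  using assms
proof (induction B rule: finite_induct)
  case empty
  then show ?case by simp
next
  case (insert b B)
  have b: "b \<notin> span B" and "independent B"
    using insert.prems insert.hyps by (auto simp: independent_insert)
  then obtain c where c: "\<And>f. (\<Sum>b\<in>B. \<bar>f b\<bar>) \<le> c * p (\<Sum>b\<in>B. f b *\<^sub>R b)"
    using insert.IH by blast
  have "\<exists>d>0. \<forall>y\<in>span B. d \<le> p (y - b)"
  \<comment> \<open>Otherwise some \<open>Y\<close> in \<open>span B\<close> tends to
    \<open>b\<close>; completeness gives it a limit \<open>y\<close> in \<open>span B\<close> as
    well, and \<open>b = y\<close> follows.\<close>
  proof (rule ccontr)
    assume "\<not> ?thesis"
    then have "\<exists>y\<in>span B. p (y - b) < inverse (real (Suc n))" for n
      by (auto simp: not_le dest!: spec[of _ "inverse (real (Suc n))"] simp del: of_nat_Suc)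
    then obtain Y where Y: "\<And>n. Y n \<in> span B" "\<And>n. p (Y n - b) < inverse (real (Suc n))"
      by metis
    have Yb: "(\<lambda>n. p (Y n - b)) \<longlonglongrightarrow> 0"
      by (rule tendsto_sandwich[OF _ _ tendsto_const LIMSEQ_inverse_real_of_nat])
        (auto intro!: always_eventually less_imp_le Y simp del: of_nat_Suc)
    then obtain y where y: "y \<in> span B" "(\<lambda>n. p (Y n - y)) \<longlonglongrightarrow> 0"
      using span_complete_if_coordinates_bounded[OF insert.hyps(1) c Cauchy_seq_if_tendsto] Y(1)
      by blast
    \<comment> \<open>Uniqueness of the limit: \<open>p\<close> is not known to be continuous, so
      the limit is taken in the upper bound for the constant \<open>p (b - y)\<close>.\<close>
    have "(\<lambda>n. K * (p (Y n - b) + p (Y n - y))) \<longlonglongrightarrow> K * (0 + 0)"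
      by (intro tendsto_intros Yb y)
    moreover have "p (b - y) \<le> K * (p (Y n - b) + p (Y n - y))" for n
      using quasi_triangle_diff[of b y "Y n"] by (simp add: minus_commute[of b])
    ultimately have "p (b - y) \<le> K * (0 + 0)"
      by (intro LIMSEQ_le_const) auto
    then have "b = y"
      using nonneg[of "b - y"] eq_0_iff[of "b - y"] by simp
    with y b show False by simp
  qed
  then obtain d where d: "d > 0" "\<And>y. y \<in> span B \<Longrightarrow> d \<le> p (y - b)"
    by blast
  \<comment> \<open>In the constant, \<open>1 / d\<close> accounts for the coefficient of
    \<open>b\<close>, and \<open>K * (1 + p b / d)\<close> is the price of passing from the whole
    sum to its part in \<open>span B\<close>.\<close>
  have "(\<Sum>b\<in>insert b B. \<bar>f b\<bar>)
      \<le> (1 / d + \<bar>c\<bar> * (K * (1 + p b / d))) * p (\<Sum>b\<in>insert b B. f b *\<^sub>R b)" for f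
  proof -
    define y where "y = (\<Sum>b\<in>B. f b *\<^sub>R b)"
    define t where "t = f b"
    have sum_eq: "(\<Sum>b\<in>insert b B. f b *\<^sub>R b) = t *\<^sub>R b + y"
      using insert.hyps by (simp add: t_def y_def)
    have "y \<in> span B"
      unfolding y_def by (intro span_sum span_scale span_base)
    have t: "\<bar>t\<bar> \<le> p (t *\<^sub>R b + y) / d"
    proof (cases "t = 0")
      case False
      \<comment> \<open>Pulling out \<open>- t\<close> writes \<open>t *\<^sub>R b + y\<close> as a
        multiple of the difference between a vector of \<open>span B\<close> and
        \<open>b\<close>.\<close>
      have "\<bar>t\<bar> * d \<le> \<bar>t\<bar> * p ((- 1 / t) *\<^sub>R y - b)"
        using d(2)[of "(- 1 / t) *\<^sub>R y"] \<open>y \<in> span B\<close> by (intro mult_left_mono) (auto intro: span_scale span_neg)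
      also have "\<dots> = p ((- t) *\<^sub>R ((- 1 / t) *\<^sub>R y - b))"
        by (simp add: scale del: scaleR_minus_left)
      also have "(- t) *\<^sub>R ((- 1 / t) *\<^sub>R y - b) = t *\<^sub>R b + y"
        using False by (simp add: scaleR_diff_right)
      finally show ?thesis
        using d(1) by (simp add: field_simps)
    qed (use d(1) in simp)
    have "p y \<le> K * (p (t *\<^sub>R b + y) + \<bar>t\<bar> * p b)"
      using quasi_triangle[of "t *\<^sub>R b + y" "- (t *\<^sub>R b)"] by (simp add: scale)
    also have "\<dots> \<le> K * (p (t *\<^sub>R b + y) + (p (t *\<^sub>R b + y) / d) * p b)"
      using t K_pos by (intro mult_left_mono add_left_mono mult_right_mono) auto
    also have "\<dots> = K * (1 + p b / d) * p (t *\<^sub>R b + y)"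
      by (simp add: algebra_simps)
    finally have y: "p y \<le> K * (1 + p b / d) * p (t *\<^sub>R b + y)" .
    have "(\<Sum>b\<in>B. \<bar>f b\<bar>) \<le> c * p y"
      unfolding y_def by (rule c)
    also have "\<dots> \<le> \<bar>c\<bar> * p y"
      by (intro mult_right_mono) auto
    also have "\<dots> \<le> \<bar>c\<bar> * (K * (1 + p b / d) * p (t *\<^sub>R b + y))"
      by (intro mult_left_mono y) auto
    finally have "\<bar>t\<bar> + (\<Sum>b\<in>B. \<bar>f b\<bar>)
        \<le> p (t *\<^sub>R b + y) / d + \<bar>c\<bar> * (K * (1 + p b / d) * p (t *\<^sub>R b + y))"
      using t by linarith
    also have "\<dots> = (1 / d + \<bar>c\<bar> * (K * (1 + p b / d))) * p (t *\<^sub>R b + y)"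
      by (simp add: algebra_simps)
    finally show ?thesis
      using insert.hyps by (simp add: sum_eq t_def)
  qed
  then show ?case by blast
qed

lemma Cauchy_seq_tendsto:
  fixes B :: "'v set"
  assumes "finite B" "independent B" "span B = UNIV" and "Cauchy_seq X"
  obtains x where "(\<lambda>n. p (X n - x)) \<longlonglongrightarrow> 0"
proof -
  obtain c where "\<And>f. (\<Sum>b\<in>B. \<bar>f b\<bar>) \<le> c * p (\<Sum>b\<in>B. f b *\<^sub>R b)"
    using coordinates_bounded[OF assms(1,2)] by blast
  from span_complete_if_coordinates_bounded[OF assms(1) this assms(4)] assms(3) that
  show ?thesis by auto
qed

end

section \<open>Passage between the cone norm and its quasi-norm\<close>

lemma quasi_norm_norm_cone_norm:
  assumes "normality_bound C K" and "cone_norm C N"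
  shows "quasi_norm (\<lambda>x. norm (N x)) K"
proof
  show K: "K > 0"
    using assms(1) by (simp add: normality_bound_def)
  show "norm (N x) = 0 \<longleftrightarrow> x = 0" for x
    using assms(2) by (simp add: cone_norm_def)
  show "norm (N (a *\<^sub>R x)) = \<bar>a\<bar> * norm (N x)" for a x
    using assms(2) by (simp add: cone_norm_def)
  show "norm (N (x + y)) \<le> K * (norm (N x) + norm (N y))" for x y
  proof -
    have "norm (N (x + y)) \<le> K * norm (N x + N y)"
      using assms unfolding normality_bound_def cone_norm_def by blast
    also have "\<dots> \<le> K * (norm (N x) + norm (N y))"
      using K by (intro mult_left_mono norm_triangle_ineq) auto
    finally show ?thesis .
  qed
qed

text \<open>The differences \<open>\<epsilon> - N (X n - x)\<close> tend to
  \<open>\<epsilon>\<close>, which lies in the open set \<open>interior C\<close>.\<close>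

lemma cone_converges_to_if_norm_tendsto:
  assumes "(\<lambda>n. norm (N (X n - x))) \<longlonglongrightarrow> 0"
  shows "cone_converges_to C N X x"
  unfolding cone_converges_to_def cone_ll_def
proof (intro allI impI)
  fix \<epsilon> assume "\<epsilon> - 0 \<in> interior C"
  moreover have "(\<lambda>n. \<epsilon> - N (X n - x)) \<longlonglongrightarrow> \<epsilon> - 0"
    by (intro tendsto_intros tendsto_norm_zero_cancel[OF assms])
  ultimately have "\<forall>\<^sub>F n in sequentially. \<epsilon> - N (X n - x) \<in> interior C"
    by (rule topological_tendstoD[OF _ open_interior, rotated])
  then obtain n0 where "\<forall>n\<ge>n0. \<epsilon> - N (X n - x) \<in> interior C"
    by (auto simp: eventually_sequentially)
  \<comment> \<open>\<open>Suc n0\<close> because the definition asks for a positive index.\<close>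
  then show "\<exists>n0>0. \<forall>n\<ge>n0. \<epsilon> - N (X n - x) \<in> interior C"
    by (intro exI[of _ "Suc n0"]) auto
qed

text \<open>Scaling by \<open>t\<close> maps \<open>C\<close> into itself and open sets to open
  sets. Thus one interior point yields arbitrarily small ones.\<close>

lemma interior_cone_scaleR:
  assumes "is_cone C" and "e \<in> interior C" and "t > 0"
  shows "t *\<^sub>R e \<in> interior C"
proof -
  have "(*\<^sub>R) t ` C \<subseteq> C"
  proof
    fix y assume "y \<in> (*\<^sub>R) t ` C"
    \<comment> \<open>The zero summand fits the two-term form of the cone axiom.\<close>
    then obtain x where "x \<in> C" "y = t *\<^sub>R x + 0 *\<^sub>R x" by auto
    with assms(1,3) show "y \<in> C"
      unfolding is_cone_def by (metis less_imp_le order_refl)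
  qed
  then have "(*\<^sub>R) t ` interior C \<subseteq> interior C"
    using assms(3) interior_subset[of C]
    by (intro interior_maximal open_scaling) auto
  with assms(2) show ?thesis by blast
qed

text \<open>The cone Cauchy condition is tested on a small multiple of \<open>e\<close>, and
  normality carries the resulting cone bound over to norms.\<close>

lemma norm_Cauchy_if_cone_Cauchy:
  assumes "is_cone C" and "normality_bound C K" and "cone_norm C N"
    and "cone_Cauchy C N X" and "e \<in> interior C" and "\<delta> > 0"
  shows "\<exists>n0. \<forall>m\<ge>n0. \<forall>n\<ge>n0. norm (N (X n - X m)) < \<delta>"
proof -
  have K: "K > 0"
    using assms(2) by (simp add: normality_bound_def)
  \<comment> \<open>Chosen so that \<open>K * norm (t *\<^sub>R e) < \<delta>\<close>; the summand 1
    gives strictness and keeps the denominator positive.\<close>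
  define t where "t = \<delta> / (K * (norm e + 1))"
  have den: "K * (norm e + 1) > 0"
    using K by (simp add: add_nonneg_pos)
  then have t: "t > 0"
    using assms(6) by (simp add: t_def)
  have "cone_ll C 0 (t *\<^sub>R e)"
    using interior_cone_scaleR[OF assms(1,5) t] by (simp add: cone_ll_def)
  then obtain n0 where n0: "\<And>m n. m \<ge> n0 \<Longrightarrow> n \<ge> n0 \<Longrightarrow> cone_ll C (N (X n - X m)) (t *\<^sub>R e)"
    using assms(4) unfolding cone_Cauchy_def by blast
  have "norm (N (X n - X m)) < \<delta>" if "m \<ge> n0" "n \<ge> n0" for m n
  proof -
    have "cone_le C (N (X n - X m)) (t *\<^sub>R e)"
      using n0[OF that] interior_subset unfolding cone_ll_def cone_le_def by blast
    moreover have "cone_le C 0 (N (X n - X m))"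
      using assms(3) unfolding cone_norm_def by blast
    ultimately have "norm (N (X n - X m)) \<le> K * norm (t *\<^sub>R e)"
      using assms(2) unfolding normality_bound_def by blast
    also have "\<dots> < t * (K * (norm e + 1))"
      using t K by (simp add: algebra_simps)
    also have "\<dots> = \<delta>"
      unfolding t_def using den by (intro nonzero_eq_divide_eq[THEN iffD1]) auto
    finally show ?thesis .
  qed
  then show ?thesis by blast
qed

theorem theorem3p2:
  fixes C :: "'e::banach set" and K :: real and N :: "'v::real_vector \<Rightarrow> 'e"
  assumes "is_cone C"
    and "normal_cone C" and "normal_constant C = K"
    and "\<exists>B. finite_dimensional_vector_space (scaleR :: real \<Rightarrow> 'v \<Rightarrow> 'v) B"
    and "cone_norm C N"
  shows "cone_complete C N"
  unfolding cone_complete_def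
proof (intro allI impI)
  fix X assume X: "cone_Cauchy C N X"
  show "\<exists>x. cone_converges_to C N X x"
  proof (cases "interior C = {}")
    case True
    then show ?thesis
      by (simp add: cone_converges_to_def cone_ll_def)
  next
    case False
    then obtain e where e: "e \<in> interior C" by blast
    obtain L where L: "normality_bound C L"
      using assms(2) unfolding normal_cone_def by blast
    interpret quasi_norm "\<lambda>x. norm (N x)" L
      by (rule quasi_norm_norm_cone_norm[OF L assms(5)])
    obtain B where "finite_dimensional_vector_space (scaleR :: real \<Rightarrow> 'v \<Rightarrow> 'v) B"
      using assms(4) by blast
    then interpret fd: finite_dimensional_vector_space "scaleR :: real \<Rightarrow> 'v \<Rightarrow> 'v" B .
    \<comment> \<open>Unfolding reduces \<open>independent\<close> and \<open>span\<close> to the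
      generic vector space constants at \<open>scaleR\<close>, in which \<open>fd\<close> states its
      facts.\<close>
    have "independent B" "span B = UNIV"
      using fd.independent_Basis fd.span_Basis
      unfolding dependent_raw_def span_raw_def by auto
    moreover have "Cauchy_seq X"
      unfolding Cauchy_seq_def
      using norm_Cauchy_if_cone_Cauchy[OF assms(1) L assms(5) X e] by blast
    ultimately obtain x where "(\<lambda>n. norm (N (X n - x))) \<longlonglongrightarrow> 0"
      using Cauchy_seq_tendsto[OF fd.finite_Basis] by blast
    then show ?thesis
      using cone_converges_to_if_norm_tendsto by blast
  qed
qed

end
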